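(* Let $\Gamma$ be a countable discrete abelian group. Let $\mathscr{C}$ be a family of infinite subsets of $\Gamma$, and suppose there exist a family $\mathscr{D}$ of subsets of $\Gamma$ and a Følner sequence $\Phi$ in $\Gamma$ such that (1) for every $C \in \mathscr{C}$ and $D \in \mathscr{D}$ one has $C \cap D \in \mathscr{C}$, and (2) $\inf_{D \in \mathscr{D}} \overline{d}_\Phi(D) = 0$. Then for every $\varepsilon > 0$ there exists $A \subseteq \Gamma$ with $\underline{d}_\Phi(A) > 1 - \varepsilon$ such that $A - t \notin \mathscr{C}$ for every $t \in \Gamma$.
   Context: A Følner sequence in $\Gamma$ is a sequence $(\Phi_N)_{N\in\mathbb{N}}$ of finite subsets of $\Gamma$ with $\lim_{N\to\infty} |(\Phi_N + x)\triangle \Phi_N|/|\Phi_N| = 0$ for all $x \in \Gamma$. For such $\Phi$, $\overline{d}_\Phi(A) = \limsup_{N\to\infty} |A\cap\Phi_N|/|\Phi_N|$ and $\underline{d}_\Phi(A) = \liminf_{N\to\infty} |A\cap\Phi_N|/|\Phi_N|$. $A - t = \{a - t : a \in A\}$. *)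

theory Defs
  imports "HOL-Analysis.Analysis"
begin

text \<open>The sets of a Folner sequence are required to be nonempty: the quotients by their
  cardinalities must make sense, whereas \<open>x / 0 = 0\<close> in HOL.\<close>

definition Folner_seq :: "(nat \<Rightarrow> 'a::ab_group_add set) \<Rightarrow> bool" where
  "Folner_seq \<Phi> \<longleftrightarrow>
     (\<forall>N. finite (\<Phi> N) \<and> \<Phi> N \<noteq> {}) \<and>
     (\<forall>x. (\<lambda>N. real (card (sym_diff ((\<lambda>y. y + x) ` \<Phi> N) (\<Phi> N))) / real (card (\<Phi> N)))
            \<longlonglongrightarrow> 0)"

text \<open>The densities are extended reals, so that the infimum of the upper densities over an
  empty family is \<open>\<infinity>\<close> rather than an unspecified real number.\<close>

definition upper_density :: "(nat \<Rightarrow> 'a set) \<Rightarrow> 'a set \<Rightarrow> ereal" where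
  "upper_density \<Phi> A = limsup (\<lambda>N. ereal (real (card (A \<inter> \<Phi> N)) / real (card (\<Phi> N))))"

definition lower_density :: "(nat \<Rightarrow> 'a set) \<Rightarrow> 'a set \<Rightarrow> ereal" where
  "lower_density \<Phi> A = liminf (\<lambda>N. ereal (real (card (A \<inter> \<Phi> N)) / real (card (\<Phi> N))))"

end

theory Submission
  imports Defs
begin

text \<open>
  Enumerate the group as \<open>t\<^sub>0, t\<^sub>1, \<dots>\<close> and pick \<open>D\<^sub>n \<in> \<D>\<close> whose upper density is so small that
  \<open>D\<^sub>n + t\<^sub>n\<close> occupies a proportion of at most \<open>\<epsilon> / 2\<^bsup>n+2\<^esup>\<close> of \<open>\<Phi>\<^sub>N\<close> for all \<open>N \<ge> N\<^sub>n\<close>. Deleting from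
  \<open>D\<^sub>n + t\<^sub>n\<close> the finite set \<open>\<Union>\<^bsub>N < N\<^sub>n\<^esub> \<Phi>\<^sub>N\<close> makes this bound true for every \<open>N\<close>, so that the union
  of all the trimmed translates occupies a proportion of at most \<open>\<epsilon> / 2\<close> of every \<open>\<Phi>\<^sub>N\<close>. Its
  complement \<open>A\<close> has lower density at least \<open>1 - \<epsilon> / 2\<close>, and \<open>(A - t\<^sub>n) \<inter> D\<^sub>n\<close> is finite for every
  \<open>n\<close>, which rules out \<open>A - t\<^sub>n \<in> \<C>\<close>.
\<close>

text \<open>Translation by \<open>- t\<close> carries the set on the left injectively into
  \<open>D\<close>. A point that lands in \<open>F\<close> is counted by
  \<open>D \<inter> F\<close>; any other lies in the shifted copy of \<open>F\<close> but outside
  \<open>F\<close>, hence in the symmetric difference.\<close>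

lemma card_translate_Int_le:
  fixes D F :: "'a::ab_group_add set"
  assumes "finite F"
  shows "card ((\<lambda>y. y + t) ` D \<inter> F) \<le> card (D \<inter> F) + card (sym_diff ((\<lambda>y. y + - t) ` F) F)"
proof -
  have "card ((\<lambda>y. y + t) ` D \<inter> F) = card ((\<lambda>y. y + - t) ` ((\<lambda>y. y + t) ` D \<inter> F))"
    by (rule card_image [symmetric]) (auto simp: inj_on_def)
  also have "\<dots> \<le> card (D \<inter> F \<union> sym_diff ((\<lambda>y. y + - t) ` F) F)"
    by (rule card_mono) (use assms in auto)
  also have "\<dots> \<le> card (D \<inter> F) + card (sym_diff ((\<lambda>y. y + - t) ` F) F)"
    by (rule card_Un_le)
  finally show ?thesis .
qed

text \<open>The factor 2 collects two errors of relative size \<open>\<delta>\<close>: one from the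
  density of \<open>D\<close>, one from the Folner condition at \<open>- t\<close>.\<close>

lemma eventually_translate_density_less:
  fixes D :: "'a::ab_group_add set" and \<delta> :: real
  assumes "Folner_seq \<Phi>" and "upper_density \<Phi> D < ereal \<delta>" and "\<delta> > 0"
  shows "\<forall>\<^sub>F N in sequentially.
    real (card ((\<lambda>y. y + t) ` D \<inter> \<Phi> N)) \<le> 2 * \<delta> * real (card (\<Phi> N))"
proof -
  have pos: "card (\<Phi> N) > 0" and fin: "finite (\<Phi> N)" for N
    using assms(1) by (auto simp: Folner_seq_def card_gt_0_iff)
  have "\<forall>\<^sub>F N in sequentially. ereal (real (card (D \<inter> \<Phi> N)) / real (card (\<Phi> N))) < ereal \<delta>"
    using assms(2) unfolding upper_density_def by (rule Limsup_lessD)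
  moreover have "\<forall>\<^sub>F N in sequentially.
      real (card (sym_diff ((\<lambda>y. y + - t) ` \<Phi> N) (\<Phi> N))) / real (card (\<Phi> N)) < \<delta>"
    by (rule order_tendstoD(2)[OF _ assms(3)]) (use assms(1) in \<open>unfold Folner_seq_def, blast\<close>)
  ultimately show ?thesis
  proof eventually_elim
    case (elim N)
    have "real (card (D \<inter> \<Phi> N)) < \<delta> * real (card (\<Phi> N))"
      "real (card (sym_diff ((\<lambda>y. y + - t) ` \<Phi> N) (\<Phi> N))) < \<delta> * real (card (\<Phi> N))"
      using elim pos[of N] by (simp_all only: ereal_less_eq less_ereal.simps(1)
        pos_divide_less_eq of_nat_0_less_iff)
    with card_translate_Int_le[OF fin, of t D N] show ?case
      by linarith
  qed
qed

text \<open>As \<open>F\<close> is finite, finitely many of the \<open>E n\<close> cover its part of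
  the union: one index \<open>k x\<close> for each point \<open>x\<close>. Finite subadditivity then
  suffices, and a finite sum of the nonnegative \<open>c n\<close> is at most
  \<open>suminf c\<close>.\<close>

lemma card_UN_Int_le_suminf:
  fixes E :: "nat \<Rightarrow> 'a set" and c :: "nat \<Rightarrow> real"
  assumes "finite F" and "summable c" and "\<And>n. c n \<ge> 0"
    and "\<And>n. real (card (E n \<inter> F)) \<le> c n * real (card F)"
  shows "real (card ((\<Union>n. E n) \<inter> F)) \<le> suminf c * real (card F)"
proof -
  have "\<forall>x\<in>(\<Union>n. E n) \<inter> F. \<exists>n. x \<in> E n" by auto
  then obtain k where k: "\<And>x. x \<in> (\<Union>n. E n) \<inter> F \<Longrightarrow> x \<in> E (k x)"
    by metis
  define I where "I = k ` ((\<Union>n. E n) \<inter> F)"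
  have fin: "finite I" using assms(1) by (simp add: I_def)
  have "(\<Union>n. E n) \<inter> F \<subseteq> (\<Union>n\<in>I. E n \<inter> F)"
    using k unfolding I_def by blast
  then have "card ((\<Union>n. E n) \<inter> F) \<le> card (\<Union>n\<in>I. E n \<inter> F)"
    by (rule card_mono[rotated]) (use fin assms(1) in auto)
  also have "\<dots> \<le> (\<Sum>n\<in>I. card (E n \<inter> F))"
    by (rule card_UN_le[OF fin])
  finally have "real (card ((\<Union>n. E n) \<inter> F)) \<le> (\<Sum>n\<in>I. real (card (E n \<inter> F)))"
    by (metis of_nat_le_iff of_nat_sum)
  also have "\<dots> \<le> (\<Sum>n\<in>I. c n * real (card F))"
    by (rule sum_mono) (rule assms(4))
  also have "\<dots> = (\<Sum>n\<in>I. c n) * real (card F)"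
    by (simp add: sum_distrib_right)
  also have "\<dots> \<le> suminf c * real (card F)"
    by (intro mult_right_mono sum_le_suminf) (use assms fin in auto)
  finally show ?thesis .
qed

text \<open>The threshold \<open>M n\<close> beyond which the bound on \<open>E n\<close> holds may
  grow with \<open>n\<close>, so the eventual bounds cannot be summed directly. After trimming they
  hold at every index and add up for each fixed \<open>N\<close>.\<close>

lemma exists_finite_trimming:
  fixes E :: "nat \<Rightarrow> 'a set" and c :: "nat \<Rightarrow> real"
  assumes "\<And>N. finite (\<Phi> N)" and "summable c" and "\<And>n. c n \<ge> 0"
    and "\<And>n. \<forall>\<^sub>F N in sequentially. real (card (E n \<inter> \<Phi> N)) \<le> c n * real (card (\<Phi> N))"
  obtains F where "\<And>n. finite (F n)"
    and "\<And>N. real (card ((\<Union>n. E n - F n) \<inter> \<Phi> N)) \<le> suminf c * real (card (\<Phi> N))"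
proof -
  from assms(4) obtain M where M:
    "\<And>n N. N \<ge> M n \<Longrightarrow> real (card (E n \<inter> \<Phi> N)) \<le> c n * real (card (\<Phi> N))"
    unfolding eventually_sequentially by metis
  define F where "F n = (\<Union>N<M n. \<Phi> N)" for n
  have bound: "real (card ((E n - F n) \<inter> \<Phi> N)) \<le> c n * real (card (\<Phi> N))" for n N
  proof (cases "N < M n")
    case True
    then have "(E n - F n) \<inter> \<Phi> N = {}" by (auto simp: F_def)
    then show ?thesis using assms(3) by simp
  next
    case False
    have "card ((E n - F n) \<inter> \<Phi> N) \<le> card (E n \<inter> \<Phi> N)"
      by (rule card_mono) (use assms(1) in auto)
    also have "real \<dots> \<le> c n * real (card (\<Phi> N))"
      using False by (intro M) simp
    finally show ?thesis by simp
  qed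
  show ?thesis
  proof
    show "finite (F n)" for n using assms(1) by (simp add: F_def)
    show "real (card ((\<Union>n. E n - F n) \<inter> \<Phi> N)) \<le> suminf c * real (card (\<Phi> N))" for N
      by (rule card_UN_Int_le_suminf) (use assms bound in auto)
  qed
qed

lemma lower_density_Compl_ge:
  fixes B :: "'a set" and c :: real
  assumes "\<And>N. finite (\<Phi> N)" and "\<And>N. \<Phi> N \<noteq> {}"
    and "\<And>N. real (card (B \<inter> \<Phi> N)) \<le> c * real (card (\<Phi> N))"
  shows "lower_density \<Phi> (- B) \<ge> ereal (1 - c)"
  unfolding lower_density_def
proof (rule Liminf_bounded, rule always_eventually, rule allI)
  fix N
  have pos: "card (\<Phi> N) > 0" using assms(1,2) by (simp add: card_gt_0_iff)
  have "card (\<Phi> N) = card (- B \<inter> \<Phi> N) + card (B \<inter> \<Phi> N)"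
    by (subst card_Un_disjoint [symmetric])
       (use assms(1) in \<open>auto intro!: arg_cong[where f = card]\<close>)
  with assms(3)[of N] have "(1 - c) * real (card (\<Phi> N)) \<le> real (card (- B \<inter> \<Phi> N))"
    by (simp add: algebra_simps)
  with pos show "ereal (1 - c) \<le> ereal (real (card (- B \<inter> \<Phi> N)) / real (card (\<Phi> N)))"
    by (simp add: pos_le_divide_eq)
qed

theorem theorem2p2:
  fixes \<C> \<D> :: "'a::{ab_group_add, countable} set set"
    and \<Phi> :: "nat \<Rightarrow> 'a set"
  assumes "\<And>C. C \<in> \<C> \<Longrightarrow> infinite C"
    and "Folner_seq \<Phi>"
    and "\<And>C D. C \<in> \<C> \<Longrightarrow> D \<in> \<D> \<Longrightarrow> C \<inter> D \<in> \<C>"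
    and "(INF D\<in>\<D>. upper_density \<Phi> D) = 0"
  shows "\<forall>\<epsilon>::real. \<epsilon> > 0 \<longrightarrow>
    (\<exists>A. lower_density \<Phi> A > ereal (1 - \<epsilon>) \<and> (\<forall>t. (\<lambda>a. a - t) ` A \<notin> \<C>))"
proof (intro allI impI)
  fix \<epsilon> :: real
  assume \<epsilon>: "\<epsilon> > 0"
  \<comment> \<open>Translating doubles \<open>\<delta> n\<close>, and the doubled values sum to
    \<open>\<epsilon> / 2\<close>; this leaves room for the strict inequality on the lower
    density.\<close>
  define \<delta> where "\<delta> n = \<epsilon> / 8 * (1 / 2) ^ n" for n
  have \<delta>_pos: "\<delta> n > 0" for n using \<epsilon> by (simp add: \<delta>_def)
  have "(\<lambda>n. \<epsilon> / 4 * (1 / 2) ^ n) sums (\<epsilon> / 4 * (1 / (1 - 1 / 2)))"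
    by (intro sums_mult geometric_sums) simp
  then have sums: "(\<lambda>n. 2 * \<delta> n) sums (\<epsilon> / 2)"
    by (simp add: \<delta>_def)
  have fin: "finite (\<Phi> N)" and ne: "\<Phi> N \<noteq> {}" for N
    using assms(2) by (auto simp: Folner_seq_def)
  have "\<exists>D\<in>\<D>. upper_density \<Phi> D < ereal (\<delta> n)" for n
    using assms(4) \<delta>_pos[of n] by (simp flip: INF_less_iff)
  then obtain D where D: "\<And>n. D n \<in> \<D>" "\<And>n. upper_density \<Phi> (D n) < ereal (\<delta> n)"
    by metis
  \<comment> \<open>\<open>from_nat\<close> is onto, possibly with repetitions, so every group
    element occurs as some \<open>t n\<close>.\<close>
  define t :: "nat \<Rightarrow> 'a" where "t = from_nat"
  define E where "E n = (\<lambda>y. y + t n) ` D n" for n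
  have "\<forall>\<^sub>F N in sequentially. real (card (E n \<inter> \<Phi> N)) \<le> 2 * \<delta> n * real (card (\<Phi> N))" for n
    unfolding E_def by (rule eventually_translate_density_less[OF assms(2) D(2) \<delta>_pos])
  then obtain F where F: "\<And>n. finite (F n)"
    "\<And>N. real (card ((\<Union>n. E n - F n) \<inter> \<Phi> N)) \<le> (\<Sum>n. 2 * \<delta> n) * real (card (\<Phi> N))"
  proof (rule exists_finite_trimming[OF fin sums_summable[OF sums], rotated])
    show "0 \<le> 2 * \<delta> n" for n using \<delta>_pos[of n] by simp
  qed blast+
  define A where "A = - (\<Union>n. E n - F n)"
  have "ereal (1 - \<epsilon>) < ereal (1 - \<epsilon> / 2)" using \<epsilon> by simp
  also have "\<dots> \<le> lower_density \<Phi> A"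
    unfolding A_def using F(2) sums_unique[OF sums]
    by (intro lower_density_Compl_ge fin ne) simp
  finally have dens: "lower_density \<Phi> A > ereal (1 - \<epsilon>)" .
  have "(\<lambda>a. a - s) ` A \<notin> \<C>" for s
  proof
    assume C: "(\<lambda>a. a - s) ` A \<in> \<C>"
    obtain n where n: "s = t n" unfolding t_def by (metis from_nat_to_nat)
    \<comment> \<open>\<open>A\<close> avoids \<open>E n - F n\<close>, so a point of
      \<open>A\<close> that the shift by \<open>- s\<close> sends into \<open>D n\<close> can only
      be one of the finitely many trimmed points.\<close>
    have "(\<lambda>a. a - s) ` A \<inter> D n \<subseteq> (\<lambda>a. a - s) ` F n"
    proof
      fix x assume x: "x \<in> (\<lambda>a. a - s) ` A \<inter> D n"
      then obtain a where a: "a \<in> A" "x = a - s" by blast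
      then have "a = x + t n" using n by simp
      with x have "a \<in> E n" by (auto simp: E_def)
      with a(1) have "a \<in> F n" by (auto simp: A_def)
      with a(2) show "x \<in> (\<lambda>a. a - s) ` F n" by blast
    qed
    then have "finite ((\<lambda>a. a - s) ` A \<inter> D n)"
      using F(1) finite_subset by blast
    \<comment> \<open>Intersecting with \<open>D n\<close> stays inside \<open>\<C>\<close>, whose
      members are all infinite.\<close>
    with assms(1) assms(3)[OF C D(1)] show False by blast
  qed
  with dens show "\<exists>A. lower_density \<Phi> A > ereal (1 - \<epsilon>) \<and> (\<forall>t. (\<lambda>a. a - t) ` A \<notin> \<C>)"
    by blast
qed

end
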